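(* Let $D$ be a strong digraph on $n\ge 3$ vertices. Then \[1\le \pi(D)\le \frac{n}{2}.\] The lower bound holds with equality if and only if $D$ has a vertex of out-degree $n-1$. The upper bound holds with equality if and only if $D$ is a dicycle (a directed cycle on all $n$ vertices). Moreover, \[1\le \rho(D)\le \frac{n}{2}.\] The lower bound holds with equality if and only if $D$ is a complete digraph. The upper bound holds with equality if and only if $D$ is strong and contains a Hamiltonian dipath $v_1v_2\dots v_n$ such that $\{v_iv_j\mid 2\le i+1<j\le n\}\subseteq A(\overline{D})$.
   Context: All digraphs are finite, without loops or parallel arcs (opposite arcs $uv$ and $vu$ may both be present). $V(D)$ and $A(D)$ are the vertex set and the arc set of $D$. A digraph $D$ is strong if for every pair $u,v$ of vertices there are a directed path from $u$ to $v$ and a directed path from $v$ to $u$. A dipath is a directed path. For a strong digraph $D$ of order $n\ge 2$, $d(u,v)$ is the length of a shortest dipath from $u$ to $v$; $\sigma(u)=\sum_{v\in V(D)}d(u,v)$; $\bar\sigma(u)=\frac{\sigma(u)}{n-1}$; the proximity is $\pi(D)=\min\{\bar\sigma(u)\mid u\in V(D)\}$ and the remoteness is $\rho(D)=\max\{\bar\sigma(u)\mid u\in V(D)\}$. The complement $\overline{D}$ has $V(\overline{D})=V(D)$ and $A(\overline{D})=\{uv\mid u\ne v\in V(D),\ uv\notin A(D)\}$. A digraph is complete if its complement has no arcs. *)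

theory Defs
  imports "Graph_Theory.Graph_Theory"
begin

text \<open>
  A finite digraph without loops or parallel arcs is a \<^locale>\<open>pair_digraph\<close>: its arcs are
  ordered pairs of distinct vertices. It is strong if \<^const>\<open>strongly_connected\<close> holds of its
  image under \<^const>\<open>with_proj\<close>.
\<close>

text \<open>
  Dipaths are the \<^const>\<open>pre_digraph.apath\<close>s, i.e. lists of consecutive arcs whose vertices are
  pairwise distinct; the length of a dipath is its number of arcs, and the empty list is the dipath
  of length 0 from a vertex to itself. The distance is meaningful only if there is some dipath
  from \<open>u\<close> to \<open>v\<close>.
\<close>
definition distance :: "'a pair_pre_digraph \<Rightarrow> 'a \<Rightarrow> 'a \<Rightarrow> nat" where
  "distance D u v = (LEAST k. \<exists>p. pre_digraph.apath (with_proj D) u p v \<and> length p = k)"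

definition total_distance :: "'a pair_pre_digraph \<Rightarrow> 'a \<Rightarrow> nat" where
  "total_distance D u = (\<Sum>v\<in>pverts D. distance D u v)"

definition average_distance :: "'a pair_pre_digraph \<Rightarrow> 'a \<Rightarrow> real" where
  "average_distance D u = real (total_distance D u) / (real (card (pverts D)) - 1)"

definition proximity :: "'a pair_pre_digraph \<Rightarrow> real" where
  "proximity D = Min {average_distance D u | u. u \<in> pverts D}"

definition remoteness :: "'a pair_pre_digraph \<Rightarrow> real" where
  "remoteness D = Max {average_distance D u | u. u \<in> pverts D}"

definition complement :: "'a pair_pre_digraph \<Rightarrow> 'a pair_pre_digraph" where
  "complement D = \<lparr> pverts = pverts D,
     parcs = {(u, v). u \<in> pverts D \<and> v \<in> pverts D \<and> u \<noteq> v \<and> (u, v) \<notin> parcs D} \<rparr>"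

definition is_complete :: "'a pair_pre_digraph \<Rightarrow> bool" where
  "is_complete D \<longleftrightarrow> parcs (complement D) = {}"

text \<open>
  The whole digraph is a directed cycle: \<open>p\<close> lists the arcs of a closed walk that repeats no vertex
  except for its end, and it uses all vertices and all arcs of \<open>D\<close>. On its own
  \<^const>\<open>pre_digraph.cycle\<close> would admit a single loop; loops do not occur in a
  \<^locale>\<open>pair_digraph\<close>.
\<close>
definition is_dicycle :: "'a pair_pre_digraph \<Rightarrow> bool" where
  "is_dicycle D \<longleftrightarrow>
     (\<exists>p. pre_digraph.cycle (with_proj D) p \<and> fst ` set p = pverts D \<and> set p = parcs D)"

definition hamiltonian_dipath :: "'a pair_pre_digraph \<Rightarrow> 'a list \<Rightarrow> bool" where
  "hamiltonian_dipath D vs \<longleftrightarrow> vpath vs (with_proj D) \<and> set vs = pverts D"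

end

theory Submission
  imports Defs
begin

text \<open>
  Fix a vertex \<open>u\<close> and consider \<open>f = distance D u\<close> on the \<open>n\<close> vertices. Every shortest dipath
  from \<open>u\<close> runs through all smaller distances, so below \<open>f v\<close> each value \<open>0, \<dots>, f v - 1\<close> is
  taken by some vertex, and \<open>f v\<close> is at most the number of vertices closer to \<open>u\<close> than \<open>v\<close>. Summing
  over \<open>v\<close> bounds the total distance of \<open>u\<close> by the number of pairs of vertices with different
  distances from \<open>u\<close>, hence by \<open>n (n - 1) / 2\<close>, and equality forces \<open>f\<close> to be injective: every
  distance layer of \<open>u\<close> is a single vertex (\<open>two_total_distance_le\<close>, \<open>two_total_distance_eq_iff\<close>).
  On the other side the \<open>n - 1\<close> vertices other than \<open>u\<close> have distance at least 1, with equality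
  throughout exactly when \<open>u\<close> dominates all of them (\<open>total_distance_eq_iff\<close>).

  Proximity and remoteness are the minimum and the maximum of the averages, so an extremal value
  of the one speaks about all vertices and an extremal value of the other about a single vertex.
  Only the upper equality cases need more. All vertices have singleton layers if and only if every
  vertex has just one out-neighbour, and a strong digraph with that property is a dicycle
  (\<open>single_valued_iff_inj_distance\<close>, \<open>is_dicycle_iff_single_valued\<close>). A single vertex with
  singleton layers yields a Hamiltonian dipath by listing the layers in order; an arc never skips a
  layer, so there is no forward arc along the dipath except its own arcs. Conversely, in a list
  of the vertices without such skipping arcs a dipath can climb at most one position per arc, so
  the total distance of the first vertex is at least \<open>0 + 1 + \<dots> + (n - 1)\<close>
  (\<open>inj_distance_iff_hamiltonian_dipath\<close>).
\<close>

section \<open>Functions without gaps on a finite set\<close>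

definition gapless :: "('a \<Rightarrow> nat) \<Rightarrow> 'a set \<Rightarrow> bool" where
  "gapless f V \<longleftrightarrow> (\<forall>v\<in>V. \<forall>k. f v = Suc k \<longrightarrow> (\<exists>w\<in>V. f w = k))"

lemma gapless_below:
  assumes gapless: "gapless f V" and v: "v \<in> V" and k: "k \<le> f v"
  shows "\<exists>w\<in>V. f w = k"
  using k
proof (induction k rule: inc_induct)
  case base
  show ?case using v by blast
next
  case (step i)
  then show ?case using gapless unfolding gapless_def by blast
qed

text \<open>
  A value \<open>f v\<close> is at most the number of \<open>w\<close> with \<open>f w < f v\<close>, because every smaller number is
  attained. Ordered pairs of distinct elements come in three kinds: ascending, descending, and
  tied; the first two kinds are equally many, and the left-hand side counts all three. The tied
  pairs are kept in the bound because they measure how far \<open>f\<close> is from being injective.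
\<close>
lemma two_sum_plus_ties_le:
  assumes fin: "finite V" and gapless: "gapless f V"
  shows "2 * sum f V + card {(v, w). v \<in> V \<and> w \<in> V \<and> v \<noteq> w \<and> f v = f w} \<le> card V * (card V - 1)"
proof -
  define L where "L = (SIGMA v:V. {w\<in>V. f w < f v})"
  define M where "M = (\<lambda>(v, w). (w, v)) ` L"
  define T where "T = {(v, w). v \<in> V \<and> w \<in> V \<and> v \<noteq> w \<and> f v = f w}"
  have "f v \<le> card {w\<in>V. f w < f v}" if v: "v \<in> V" for v
  proof -
    have "{..<f v} \<subseteq> f ` {w\<in>V. f w < f v}"
    proof
      fix k assume "k \<in> {..<f v}"
      then obtain w where "w \<in> V" "f w = k" using gapless_below[OF gapless v, of k] by auto
      then show "k \<in> f ` {w\<in>V. f w < f v}" using \<open>k \<in> {..<f v}\<close> by auto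
    qed
    then have "card {..<f v} \<le> card {w\<in>V. f w < f v}"
      using fin by (intro surj_card_le) auto
    then show ?thesis by simp
  qed
  then have "sum f V \<le> (\<Sum>v\<in>V. card {w\<in>V. f w < f v})"
    by (rule sum_mono)
  then have L: "sum f V \<le> card L"
    using fin by (simp add: L_def)
  have M: "card M = card L"
    unfolding M_def by (rule card_image) (auto simp: inj_on_def)
  have finL: "finite L" using fin by (simp add: L_def)
  have finM: "finite M" using finL by (simp add: M_def)
  have finT: "finite T"
    by (rule finite_subset[of _ "V \<times> V"]) (use fin in \<open>auto simp: T_def\<close>)
  have "card L + card M + card T = card (L \<union> M \<union> T)"
  proof -
    have "L \<inter> M = {}" "(L \<union> M) \<inter> T = {}"
      unfolding L_def M_def T_def by auto
    then show ?thesis using finL finM finT by (simp add: card_Un_disjoint)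
  qed
  also have "L \<union> M \<union> T = (SIGMA v:V. V - {v})"
    unfolding L_def M_def T_def by (auto simp: image_iff)
  also have "card \<dots> = card V * (card V - 1)"
    using fin by simp
  finally show ?thesis using L M by (simp add: T_def)
qed

lemma two_sum_lessThan: "2 * (\<Sum>i<n. i) = n * (n - 1)" for n :: nat
proof (induction n)
  case (Suc n)
  then show ?case by (cases n) auto
qed simp

text \<open>
  Equality leaves no room for tied pairs. Conversely, an injective function without gaps takes
  exactly the values \<open>0, \<dots>, card V - 1\<close>.
\<close>
lemma
  assumes fin: "finite V" and gapless: "gapless f V"
  shows two_sum_eq_iff_inj_on: "2 * sum f V = card V * (card V - 1) \<longleftrightarrow> inj_on f V"
    and image_eq_lessThan_if_inj_on: "inj_on f V \<Longrightarrow> f ` V = {..<card V}"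
proof -
  let ?T = "{(v, w). v \<in> V \<and> w \<in> V \<and> v \<noteq> w \<and> f v = f w}"
  have finT: "finite ?T"
    by (rule finite_subset[of _ "V \<times> V"]) (use fin in auto)
  show img: "f ` V = {..<card V}" if inj: "inj_on f V"
  proof -
    have "f ` V \<subseteq> {..<card V}"
    proof
      fix x assume "x \<in> f ` V"
      then obtain v where v: "v \<in> V" "x = f v" by auto
      have "{..x} \<subseteq> f ` V"
        using gapless_below[OF gapless v(1)] v(2) by (fastforce simp: image_iff)
      then have "card {..x} \<le> card V" using fin by (rule surj_card_le[rotated])
      then show "x \<in> {..<card V}" by simp
    qed
    moreover have "card (f ` V) = card {..<card V}" using inj by (simp add: card_image)
    ultimately show ?thesis by (intro card_subset_eq) auto
  qed
  show "2 * sum f V = card V * (card V - 1) \<longleftrightarrow> inj_on f V"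
  proof
    assume "2 * sum f V = card V * (card V - 1)"
    then have "card ?T = 0"
      using two_sum_plus_ties_le[OF assms] by simp
    then have "?T = {}" using finT by simp
    then show "inj_on f V" by (auto simp: inj_on_def)
  next
    assume inj: "inj_on f V"
    have "sum f V = \<Sum> (f ` V)" using inj by (simp add: sum.reindex)
    then show "2 * sum f V = card V * (card V - 1)"
      using img[OF inj] two_sum_lessThan[of "card V"] by simp
  qed
qed

section \<open>Distances in a strong digraph\<close>

locale strong_digraph = pair_digraph +
  assumes strong: "strongly_connected (with_proj G)"
begin

lemma obtain_shortest_apath:
  assumes "u \<in> pverts G" "v \<in> pverts G"
  obtains p where "apath u p v" "length p = distance G u v"
proof -
  have "\<exists>p. apath u p v"
    using strong assms by (auto simp: strongly_connected_def reachable_apath)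
  then have "\<exists>k p. apath u p v \<and> length p = k" by blast
  from LeastI_ex[OF this] show ?thesis
    using that unfolding distance_def by blast
qed

text \<open>
  Cutting closed subwalks out of a walk only shortens it, so minimising over dipaths is the same
  as minimising over walks. Walks, unlike dipaths, can be extended freely.
\<close>
lemma distance_le_awalk:
  assumes "awalk u p v"
  shows "distance G u v \<le> length p"
proof -
  have "\<exists>q. apath u q v \<and> length q \<le> length p"
    using assms
  proof (induct rule: awalk_to_apath_induct)
    case (path p)
    then show ?case by (auto simp: apath_def)
  next
    case (decomp p q r s)
    have "p = q @ r @ s"
      using awalk_cyc_decomp_has_prop[OF decomp(1,3)] decomp(2) by auto
    then show ?case using decomp(4) by fastforce
  qed
  then obtain q where q: "apath u q v" "length q \<le> length p" by blast
  have "distance G u v \<le> length q"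
    unfolding distance_def by (rule Least_le) (use q(1) in blast)
  then show ?thesis using q(2) by simp
qed

lemma distance_self: "u \<in> pverts G \<Longrightarrow> distance G u u = 0"
  using distance_le_awalk[of u "[]" u] by (simp add: awalk_Nil_iff)

lemma distance_eq_0D:
  assumes "u \<in> pverts G" "v \<in> pverts G" "distance G u v = 0"
  shows "u = v"
  using obtain_shortest_apath[OF assms(1,2)] assms(3) by (metis apath_Nil_iff length_0_conv)

lemma distance_arc_le:
  assumes u: "u \<in> pverts G" and a: "(v, w) \<in> parcs G"
  shows "distance G u w \<le> Suc (distance G u v)"
proof -
  obtain p where p: "apath u p v" "length p = distance G u v"
    using obtain_shortest_apath[OF u in_arcsD1[OF a]] by blast
  then have "awalk u (p @ [(v, w)]) w"
    using a by (auto simp: awalk_simps in_arcsD2 dest!: awalkI_apath)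
  from distance_le_awalk[OF this] p(2) show ?thesis by simp
qed

lemma distance_pred:
  assumes u: "u \<in> pverts G" and v: "v \<in> pverts G" and d: "distance G u v = Suc k"
  obtains w where "(w, v) \<in> parcs G" "distance G u w = k"
proof -
  obtain p where p: "apath u p v" "length p = Suc k"
    using obtain_shortest_apath[OF u v] d by auto
  obtain q e where q: "p = q @ [e]" "length q = k"
    using p(2) by (metis length_Suc_conv_rev)
  have "awalk u (q @ [e]) v" using awalkI_apath[OF p(1)] q(1) by metis
  then have qw: "awalk u q (fst e)" and e: "e \<in> parcs G" "snd e = v"
    by (auto simp: awalk_simps)
  then have arc: "(fst e, v) \<in> parcs G" by auto
  have "distance G u (fst e) = k"
    using distance_le_awalk[OF qw] distance_arc_le[OF u arc] q(2) d by simp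
  then show ?thesis using that arc by blast
qed

lemma distance_eq_1_iff:
  assumes u: "u \<in> pverts G" and v: "v \<in> pverts G"
  shows "distance G u v = 1 \<longleftrightarrow> (u, v) \<in> parcs G"
proof
  assume "distance G u v = 1"
  then obtain w where "(w, v) \<in> parcs G" "distance G u w = 0"
    using distance_pred[OF u v, of 0] by auto
  then show "(u, v) \<in> parcs G" using distance_eq_0D[OF u] in_arcsD1 by blast
next
  assume a: "(u, v) \<in> parcs G"
  then have "u \<noteq> v" by (rule no_loops')
  then show "distance G u v = 1"
    using distance_arc_le[OF u a] distance_self[OF u] distance_eq_0D[OF u v] by linarith
qed

text \<open>
  A potential that rises by at most 1 along each arc certifies a lower bound for distances.
\<close>
lemma potential_le_distance:
  fixes g :: "'a \<Rightarrow> nat"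
  assumes g: "\<And>x y. (x, y) \<in> parcs G \<Longrightarrow> g y \<le> Suc (g x)"
    and u: "u \<in> pverts G" and v: "v \<in> pverts G"
  shows "g v \<le> g u + distance G u v"
  using v
proof (induction "distance G u v" arbitrary: v)
  case 0
  then have "u = v" using distance_eq_0D[OF u, of v] by simp
  then show ?case by simp
next
  case (Suc k)
  obtain w where w: "(w, v) \<in> parcs G" "distance G u w = k"
    using distance_pred[OF u \<open>v \<in> pverts G\<close> Suc.hyps(2)[symmetric]] by blast
  then show ?case using Suc.hyps(1)[of w] Suc.hyps(2) g[OF w(1)] in_arcsD1[OF w(1)] by simp
qed

section \<open>Extremal total distances\<close>

lemma distance_gapless:
  assumes "u \<in> pverts G"
  shows "gapless (distance G u) (pverts G)"
  unfolding gapless_def using distance_pred[OF assms] in_arcsD1 by metis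

lemma two_total_distance_le:
  assumes "u \<in> pverts G"
  shows "2 * total_distance G u \<le> card (pverts G) * (card (pverts G) - 1)"
  using two_sum_plus_ties_le[OF pair_finite_verts distance_gapless[OF assms]]
  unfolding total_distance_def by simp

lemma two_total_distance_eq_iff:
  assumes "u \<in> pverts G"
  shows "2 * total_distance G u = card (pverts G) * (card (pverts G) - 1)
    \<longleftrightarrow> inj_on (distance G u) (pverts G)"
  using two_sum_eq_iff_inj_on[OF pair_finite_verts distance_gapless[OF assms]]
  unfolding total_distance_def by simp

text \<open>
  Both halves come from splitting off 1 from each of the \<open>n - 1\<close> positive distances: the
  remaining sum counts the excess, which vanishes exactly if all these distances are 1.
\<close>
lemma
  assumes u: "u \<in> pverts G"
  shows total_distance_ge: "card (pverts G) - 1 \<le> total_distance G u"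
    and total_distance_eq_iff: "total_distance G u = card (pverts G) - 1
      \<longleftrightarrow> (\<forall>v\<in>pverts G - {u}. (u, v) \<in> parcs G)"
proof -
  let ?W = "pverts G - {u}"
  have fin: "finite ?W" using pair_finite_verts by simp
  have ge1: "1 \<le> distance G u v" if "v \<in> ?W" for v
    using distance_eq_0D[OF u, of v] that by fastforce
  have "total_distance G u = (\<Sum>v\<in>?W. distance G u v)"
    unfolding total_distance_def
    using pair_finite_verts u distance_self[OF u] by (subst sum.remove[of _ u]) auto
  also have "\<dots> = (\<Sum>v\<in>?W. 1 + (distance G u v - 1))"
    by (rule sum.cong[OF refl], rule le_add_diff_inverse[symmetric], rule ge1)
  also have "\<dots> = card ?W + (\<Sum>v\<in>?W. distance G u v - 1)"
    by (simp only: sum.distrib) simp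
  also have "card ?W = card (pverts G) - 1"
    using u pair_finite_verts by simp
  finally have *: "total_distance G u = card (pverts G) - 1 + (\<Sum>v\<in>?W. distance G u v - 1)" .
  then show "card (pverts G) - 1 \<le> total_distance G u" by simp
  have "total_distance G u = card (pverts G) - 1 \<longleftrightarrow> (\<forall>v\<in>?W. distance G u v - 1 = 0)"
    using * fin by simp
  also have "\<dots> \<longleftrightarrow> (\<forall>v\<in>?W. distance G u v = 1)"
    using ge1 by (metis diff_is_0_eq le_antisym order_refl)
  also have "\<dots> \<longleftrightarrow> (\<forall>v\<in>?W. (u, v) \<in> parcs G)"
    using distance_eq_1_iff[OF u] by auto
  finally show "total_distance G u = card (pverts G) - 1 \<longleftrightarrow> (\<forall>v\<in>?W. (u, v) \<in> parcs G)" .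
qed

lemma out_degree_eq_iff:
  assumes u: "u \<in> pverts G"
  shows "out_degree (with_proj G) u = card (pverts G) - 1
    \<longleftrightarrow> (\<forall>v\<in>pverts G - {u}. (u, v) \<in> parcs G)"
proof -
  let ?N = "{v. (u, v) \<in> parcs G}"
  have "out_arcs (with_proj G) u = Pair u ` ?N"
    by (auto simp: out_arcs_def)
  then have "out_degree (with_proj G) u = card ?N"
    by (simp add: out_degree_def card_image inj_on_def)
  moreover have sub: "?N \<subseteq> pverts G - {u}"
    using in_arcsD2 no_loops' by auto
  moreover have "card (pverts G - {u}) = card (pverts G) - 1"
    using u pair_finite_verts by simp
  moreover have "card ?N = card (pverts G - {u}) \<longleftrightarrow> ?N = pverts G - {u}"
    using sub pair_finite_verts by (metis card_subset_eq finite_Diff)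
  ultimately show ?thesis by auto
qed

lemma is_complete_iff:
  "is_complete G \<longleftrightarrow> (\<forall>u\<in>pverts G. \<forall>v\<in>pverts G - {u}. (u, v) \<in> parcs G)"
  by (auto simp: is_complete_def complement_def)

section \<open>Dicycles\<close>

text \<open>
  If out-neighbours are unique, then two vertices at equal distance from \<open>u\<close> have predecessors at
  equal distance, and these coincide by induction. Conversely, two out-neighbours of \<open>u\<close> are both at
  distance 1 from \<open>u\<close>.
\<close>
lemma single_valued_iff_inj_distance:
  "single_valued (parcs G) \<longleftrightarrow> (\<forall>u\<in>pverts G. inj_on (distance G u) (pverts G))"
proof
  assume sv: "single_valued (parcs G)"
  show "\<forall>u\<in>pverts G. inj_on (distance G u) (pverts G)"
  proof (intro ballI inj_onI)
    fix u v w
    assume u: "u \<in> pverts G" and "v \<in> pverts G" "w \<in> pverts G" "distance G u v = distance G u w"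
    then show "v = w"
    proof (induction "distance G u v" arbitrary: v w)
      case 0
      then show ?case using distance_eq_0D[OF u] by metis
    next
      case (Suc k)
      obtain v' where v': "(v', v) \<in> parcs G" "distance G u v' = k"
        using distance_pred[OF u, of v k] Suc by metis
      obtain w' where w': "(w', w) \<in> parcs G" "distance G u w' = k"
        using distance_pred[OF u, of w k] Suc by metis
      have "v' = w'" using Suc.hyps(1)[of v' w'] v' w' u in_arcsD1 by metis
      then show ?case using v'(1) w'(1) sv by (auto dest: single_valuedD)
    qed
  qed
next
  assume inj: "\<forall>u\<in>pverts G. inj_on (distance G u) (pverts G)"
  show "single_valued (parcs G)"
  proof (rule single_valuedI)
    fix u v w assume a: "(u, v) \<in> parcs G" "(u, w) \<in> parcs G"
    then have V: "u \<in> pverts G" "v \<in> pverts G" "w \<in> pverts G"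
      using wellformed' by blast+
    then have "distance G u v = distance G u w"
      using a distance_eq_1_iff by metis
    then show "v = w" using inj V by (meson inj_onD)
  qed
qed

lemma ends_of_closed_awalk:
  assumes p: "awalk u p u" and ne: "p \<noteq> []"
  shows "u \<in> fst ` set p" and "snd ` set p \<subseteq> fst ` set p"
proof -
  have *: "pawalk_verts u p = map fst p @ [snd (last p)]"
    using awalk_verts_conv[of u p] ne by simp
  have "hd (pawalk_verts u p) = u" "last (pawalk_verts u p) = u"
    using p by auto
  then have h: "fst (hd p) = u" and l: "snd (last p) = u"
    using * ne by (auto simp: hd_append hd_map)
  show u: "u \<in> fst ` set p" using h ne by force
  show "snd ` set p \<subseteq> fst ` set p"
  proof
    fix y assume "y \<in> snd ` set p"
    then have "y \<in> set (pawalk_verts u p)"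
      using awalk_verts_arc2[OF p] by auto
    then show "y \<in> fst ` set p" using * l u by auto
  qed
qed

text \<open>
  On a dicycle the heads of the arcs are pairwise distinct by definition; as every vertex is also
  the tail of an arc, counting makes the tails distinct as well. Conversely, an arc \<open>(u, w)\<close>
  followed by a shortest dipath from \<open>w\<close> back to \<open>u\<close> is a cycle. If out-neighbours are unique, no arc
  leaves it, so by strength it covers everything.
\<close>
lemma is_dicycle_iff_single_valued:
  assumes n: "2 \<le> card (pverts G)"
  shows "is_dicycle G \<longleftrightarrow> single_valued (parcs G)"
proof
  assume "is_dicycle G"
  then obtain p u where p: "awalk u p u" "distinct (tl (pawalk_verts u p))" "p \<noteq> []"
    and fst_p: "fst ` set p = pverts G" and set_p: "set p = parcs G"
    by (auto simp: is_dicycle_def cycle_def)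
  have "pawalk_verts u p = fst (hd p) # map snd p"
    using awalk_verts_conv'[of u p u] p by auto
  then have "inj_on snd (parcs G)"
    using p(2) set_p by (auto simp: distinct_map)
  then have "card (parcs G) = card (snd ` parcs G)"
    by (simp add: card_image)
  also have "\<dots> \<le> card (pverts G)"
    by (rule card_mono[OF pair_finite_verts]) (use arc_snd_in_verts in blast)
  finally have "card (parcs G) \<le> card (fst ` parcs G)"
    using fst_p set_p by simp
  then have "card (fst ` parcs G) = card (parcs G)"
    using card_image_le[OF pair_finite_arcs, of fst] by simp
  then have "inj_on fst (parcs G)"
    using pair_finite_arcs by (intro eq_card_imp_inj_on)
  then show "single_valued (parcs G)"
    by (force simp: inj_on_def single_valued_def)
next
  assume sv: "single_valued (parcs G)"
  obtain u v where uv: "u \<in> pverts G" "v \<in> pverts G" "u \<noteq> v"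
    using n by (metis One_nat_def card_le_Suc0_iff_eq not_less_eq_eq numeral_2_eq_2 pair_finite_verts)
  have "u \<rightarrow>\<^sup>*\<^bsub>with_proj G\<^esub> v" using strong uv by auto
  then obtain w where uw: "(u, w) \<in> parcs G"
    using uv(3) by (cases rule: converse_reachable_cases) auto
  have w: "w \<in> pverts G" using in_arcsD2[OF uw] .
  obtain q where q: "apath w q u" using obtain_shortest_apath[OF w uv(1)] by blast
  define p where "p = (u, w) # q"
  have aw: "awalk u p u" and dist: "distinct (tl (pawalk_verts u p))"
    using q uw by (auto simp: p_def apath_def awalk_simps)
  have cyc: "cycle p" unfolding cycle_def using aw dist by (auto simp: p_def)
  have sub: "set p \<subseteq> parcs G" using aw by auto
  have ends: "u \<in> fst ` set p" "snd ` set p \<subseteq> fst ` set p"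
    using ends_of_closed_awalk[OF aw] by (auto simp: p_def)
  have arcs: "(x, y) \<in> set p" if x: "x \<in> fst ` set p" and a: "(x, y) \<in> parcs G" for x y
  proof -
    obtain z where "(x, z) \<in> set p" using x by auto
    then show ?thesis using a sub sv by (metis single_valuedD subsetD)
  qed
  have "x \<in> fst ` set p" if "x \<in> pverts G" for x
  proof -
    have "u \<rightarrow>\<^sup>*\<^bsub>with_proj G\<^esub> x" using strong uv(1) that by auto
    then show ?thesis
    proof (induction rule: reachable_induct)
      case base
      show ?case by (rule ends(1))
    next
      case (step x y)
      then have "(x, y) \<in> set p" using arcs by simp
      then show ?case using ends(2) by force
    qed
  qed
  moreover have "fst ` set p \<subseteq> pverts G" using sub arc_fst_in_verts by blast
  ultimately have V: "fst ` set p = pverts G" by blast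
  have "set p = parcs G"
  proof
    show "parcs G \<subseteq> set p"
      using arcs in_arcsD1 by (auto simp: V)
  qed (rule sub)
  then show "is_dicycle G" unfolding is_dicycle_def using cyc V by blast
qed

section \<open>Hamiltonian dipaths without forward chords\<close>

lemma set_vwalk_arcs_conv_nth:
  "set (vwalk_arcs vs) = {(vs ! i, vs ! Suc i) | i. Suc i < length vs}"
proof (induction vs rule: vwalk_arcs.induct)
  case (3 x y xs)
  have "{((x # y # xs) ! i, (x # y # xs) ! Suc i) | i. Suc i < length (x # y # xs)}
    = insert (x, y) {((y # xs) ! i, (y # xs) ! Suc i) | i. Suc i < length (y # xs)}"
    (is "?A = ?B")
  proof
    show "?A \<subseteq> ?B"
    proof
      fix e assume "e \<in> ?A"
      then obtain i where "e = ((x # y # xs) ! i, (x # y # xs) ! Suc i)" "Suc i < length (x # y # xs)"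
        by blast
      then show "e \<in> ?B" by (cases i) auto
    qed
    show "?B \<subseteq> ?A" by force
  qed
  then show ?case using 3 by simp
qed auto

definition no_forward_chord :: "'a list \<Rightarrow> bool" where
  "no_forward_chord vs \<longleftrightarrow>
     (\<forall>i j. Suc i < j \<longrightarrow> j < length vs \<longrightarrow> (vs ! i, vs ! j) \<notin> parcs G)"

lemma hamiltonian_dipathD:
  assumes "hamiltonian_dipath G vs"
  shows "distinct vs" "set vs = pverts G" "length vs = card (pverts G)"
proof -
  show "distinct vs" "set vs = pverts G"
    using assms by (simp_all add: hamiltonian_dipath_def vpath_def)
  then show "length vs = card (pverts G)"
    using distinct_card by metis
qed

text \<open>
  Passes between positions counted from 0 and positions counted from 1. The pairs of positions
  denote distinct vertices because the list is distinct, so being an arc of the complement is the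
  same as not being an arc.
\<close>
lemma no_forward_chord_iff_complement:
  assumes vs: "hamiltonian_dipath G vs"
  shows "no_forward_chord vs \<longleftrightarrow>
    {(vs ! (i - 1), vs ! (j - 1)) | i j. 2 \<le> i + 1 \<and> i + 1 < j \<and> j \<le> card (pverts G)}
      \<subseteq> parcs (complement G)"
proof -
  note H = hamiltonian_dipathD[OF vs]
  have "{(vs ! (i - 1), vs ! (j - 1)) | i j. 2 \<le> i + 1 \<and> i + 1 < j \<and> j \<le> card (pverts G)}
    = {(vs ! i, vs ! j) | i j. Suc i < j \<and> j < length vs}" (is "?A = ?B")
  proof (intro subset_antisym subsetI)
    fix e assume "e \<in> ?A"
    then obtain i j where "e = (vs ! (i - 1), vs ! (j - 1))" "2 \<le> i + 1" "i + 1 < j" "j \<le> length vs"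
      using H by auto
    then show "e \<in> ?B" by (intro CollectI exI[of _ "i - 1"] exI[of _ "j - 1"]) auto
  next
    fix e assume "e \<in> ?B"
    then obtain i j where "e = (vs ! i, vs ! j)" "Suc i < j" "j < length vs" by auto
    then show "e \<in> ?A" using H by (intro CollectI exI[of _ "Suc i"] exI[of _ "Suc j"]) auto
  qed
  moreover have "?B \<subseteq> parcs (complement G) \<longleftrightarrow> no_forward_chord vs"
  proof -
    have "(vs ! i, vs ! j) \<in> parcs (complement G) \<longleftrightarrow> (vs ! i, vs ! j) \<notin> parcs G"
      if "Suc i < j" "j < length vs" for i j
    proof -
      have "vs ! i \<in> pverts G" "vs ! j \<in> pverts G" using that H(2) nth_mem by fastforce+
      moreover have "vs ! i \<noteq> vs ! j" using that H(1) by (simp add: nth_eq_iff_index_eq)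
      ultimately show ?thesis by (simp add: complement_def)
    qed
    then show ?thesis unfolding no_forward_chord_def by blast
  qed
  ultimately show ?thesis by simp
qed

text \<open>
  The layers of \<open>u\<close> are listed in the order of their distance. The predecessor of the vertex at
  distance \<open>i + 1\<close> on a shortest dipath has distance \<open>i\<close>, so it is the vertex listed just before;
  a forward chord would make its head closer to \<open>u\<close> than its layer says.
\<close>
lemma hamiltonian_dipath_if_inj_distance:
  assumes u: "u \<in> pverts G" and inj: "inj_on (distance G u) (pverts G)"
  shows "\<exists>vs. hamiltonian_dipath G vs \<and> no_forward_chord vs"
proof -
  let ?V = "pverts G" and ?n = "card (pverts G)"
  \<comment> \<open>\<open>g k\<close> is the only vertex of the layer at distance \<open>k\<close>.\<close>
  define g where "g = inv_into ?V (distance G u)"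
  define vs where "vs = map g [0..<?n]"
  have img: "distance G u ` ?V = {..<?n}"
    using image_eq_lessThan_if_inj_on[OF pair_finite_verts distance_gapless[OF u] inj] by simp
  have gV: "g k \<in> ?V" and dg: "distance G u (g k) = k" if "k < ?n" for k
    using that img unfolding g_def by (auto intro: inv_into_into f_inv_into_f)
  have gd: "g (distance G u v) = v" if "v \<in> ?V" for v
    unfolding g_def using inj that by simp
  have set: "set vs = ?V"
  proof
    show "set vs \<subseteq> ?V" using gV by (auto simp: vs_def)
    show "?V \<subseteq> set vs"
    proof
      fix v assume v: "v \<in> ?V"
      then have "distance G u v < ?n" using img by blast
      then have "g (distance G u v) \<in> set vs" by (simp add: vs_def)
      then show "v \<in> set vs" using gd[OF v] by simp
    qed
  qed
  have "inj_on g {..<?n}"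
    by (rule inj_on_inverseI[of _ "distance G u"]) (simp add: dg)
  then have "distinct vs"
    by (simp add: vs_def distinct_map atLeast0LessThan)
  have arc: "(g i, g (Suc i)) \<in> parcs G" if i: "Suc i < ?n" for i
  proof -
    obtain w where "(w, g (Suc i)) \<in> parcs G" "distance G u w = i"
      using distance_pred[OF u gV[OF i] dg[OF i]] by blast
    then show ?thesis using gd[of w] in_arcsD1 by metis
  qed
  have "?n > 0" using u pair_finite_verts by (metis card_gt_0_iff empty_iff)
  then have "vwalk vs (with_proj G)"
    unfolding vwalk_def using arc set by (auto simp: set_vwalk_arcs_conv_nth vs_def)
  then have "hamiltonian_dipath G vs"
    using \<open>distinct vs\<close> set by (auto simp: hamiltonian_dipath_def)
  moreover have "no_forward_chord vs"
    unfolding no_forward_chord_def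
  proof (intro allI impI notI)
    fix i j assume ij: "Suc i < j" "j < length vs" and a: "(vs ! i, vs ! j) \<in> parcs G"
    then have "distance G u (g j) \<le> Suc (distance G u (g i))"
      using distance_arc_le[OF u a] by (simp add: vs_def)
    then show False using ij dg by (simp add: vs_def)
  qed
  ultimately show ?thesis by blast
qed

text \<open>
  The position in the list is a potential that rises by at most 1 along each arc, so
  the vertex at position \<open>i\<close> has distance at least \<open>i\<close> from the first one. These distances already
  add up to the maximum of a total distance.
\<close>
lemma inj_distance_if_hamiltonian_dipath:
  assumes ham: "hamiltonian_dipath G vs" and nfc: "no_forward_chord vs"
  shows "inj_on (distance G (vs ! 0)) (pverts G)"
proof -
  let ?n = "card (pverts G)" and ?u = "vs ! 0"
  note H = hamiltonian_dipathD[OF ham]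
  have bij: "bij_betw ((!) vs) {..<?n} (pverts G)"
    using H by (intro bij_betw_nth) auto
  have "?n > 0" using strong pair_finite_verts by (auto simp: card_gt_0_iff strongly_connected_def)
  then have u: "?u \<in> pverts G" using H by (metis nth_mem)
  define pos where "pos = inv_into {..<?n} ((!) vs)"
  have pos: "pos (vs ! i) = i" if "i < ?n" for i
    unfolding pos_def using that bij_betw_inv_into_left[OF bij] by simp
  have "pos y \<le> Suc (pos x)" if a: "(x, y) \<in> parcs G" for x y
  proof -
    obtain i j where "x = vs ! i" "i < ?n" "y = vs ! j" "j < ?n"
      using in_arcsD1[OF a] in_arcsD2[OF a] H by (metis in_set_conv_nth)
    then show ?thesis using nfc a H pos unfolding no_forward_chord_def
      by (metis not_less)
  qed
  then have "pos v \<le> pos ?u + distance G ?u v" if "v \<in> pverts G" for v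
    using potential_le_distance u that by blast
  then have ge: "i \<le> distance G ?u (vs ! i)" if "i < ?n" for i
    using that pos \<open>?n > 0\<close> H by (metis add_0 nth_mem)
  have "(\<Sum>i<?n. i) \<le> (\<Sum>i<?n. distance G ?u (vs ! i))"
    using ge by (intro sum_mono) auto
  also have "\<dots> = total_distance G ?u"
    unfolding total_distance_def by (rule sum.reindex_bij_betw[OF bij])
  finally have "?n * (?n - 1) \<le> 2 * total_distance G ?u"
    using two_sum_lessThan[of ?n] by simp
  then show ?thesis
    using two_total_distance_le[OF u] two_total_distance_eq_iff[OF u] by simp
qed

lemma inj_distance_iff_hamiltonian_dipath:
  "(\<exists>u\<in>pverts G. inj_on (distance G u) (pverts G))
    \<longleftrightarrow> (\<exists>vs. hamiltonian_dipath G vs \<and> no_forward_chord vs)"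
proof
  assume "\<exists>vs. hamiltonian_dipath G vs \<and> no_forward_chord vs"
  then obtain vs where vs: "hamiltonian_dipath G vs" "no_forward_chord vs" by blast
  have "vs \<noteq> []" using vs(1) by (auto simp: hamiltonian_dipath_def)
  then have "vs ! 0 \<in> pverts G" using hamiltonian_dipathD(2)[OF vs(1)] nth_mem by blast
  then show "\<exists>u\<in>pverts G. inj_on (distance G u) (pverts G)"
    using inj_distance_if_hamiltonian_dipath[OF vs] by blast
qed (use hamiltonian_dipath_if_inj_distance in blast)

section \<open>Proximity and remoteness\<close>

lemma average_distance_bounds:
  assumes n: "2 \<le> card (pverts G)" and u: "u \<in> pverts G"
  shows "1 \<le> average_distance G u"
    and "average_distance G u \<le> card (pverts G) / 2"
    and "average_distance G u = 1 \<longleftrightarrow> (\<forall>v\<in>pverts G - {u}. (u, v) \<in> parcs G)"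
    and "average_distance G u = card (pverts G) / 2 \<longleftrightarrow> inj_on (distance G u) (pverts G)"
proof -
  let ?n = "card (pverts G)" and ?t = "total_distance G u"
  have m: "real (?n - 1) = real ?n - 1" "real ?n - 1 > 0" using n by auto
  have "real (?n - 1) \<le> real ?t"
    using total_distance_ge[OF u] by (simp only: of_nat_le_iff)
  then show "1 \<le> average_distance G u"
    using m by (simp add: average_distance_def)
  have "real (2 * ?t) \<le> real (?n * (?n - 1))"
    using two_total_distance_le[OF u] by (simp only: of_nat_le_iff)
  then show "average_distance G u \<le> ?n / 2"
    using m by (simp add: average_distance_def field_simps)
  have "average_distance G u = 1 \<longleftrightarrow> real ?t = real (?n - 1)"
    using m by (auto simp: average_distance_def)
  then show "average_distance G u = 1 \<longleftrightarrow> (\<forall>v\<in>pverts G - {u}. (u, v) \<in> parcs G)"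
    using total_distance_eq_iff[OF u] by (simp only: of_nat_eq_iff)
  have "average_distance G u = ?n / 2 \<longleftrightarrow> real (2 * ?t) = real (?n * (?n - 1))"
    using m by (simp add: average_distance_def field_simps)
  then show "average_distance G u = ?n / 2 \<longleftrightarrow> inj_on (distance G u) (pverts G)"
    using two_total_distance_eq_iff[OF u] by (simp only: of_nat_eq_iff)
qed

end

lemma Min_image_eq_iff:
  fixes f :: "'a \<Rightarrow> real"
  assumes "finite V" "V \<noteq> {}"
  shows "(\<And>v. v \<in> V \<Longrightarrow> a \<le> f v) \<Longrightarrow> Min (f ` V) = a \<longleftrightarrow> (\<exists>v\<in>V. f v = a)"
    and "(\<And>v. v \<in> V \<Longrightarrow> f v \<le> b) \<Longrightarrow> Min (f ` V) = b \<longleftrightarrow> (\<forall>v\<in>V. f v = b)"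
proof -
  obtain v where v: "v \<in> V" using assms by blast
  have eq: "Min (f ` V) = c \<longleftrightarrow> (\<exists>v\<in>V. f v = c) \<and> (\<forall>v\<in>V. c \<le> f v)" for c
    using assms by (auto simp: Min_eq_iff)
  {
    assume "\<And>v. v \<in> V \<Longrightarrow> a \<le> f v"
    then show "Min (f ` V) = a \<longleftrightarrow> (\<exists>v\<in>V. f v = a)"
      unfolding eq using v by (metis order_antisym order_refl)
  next
    assume "\<And>v. v \<in> V \<Longrightarrow> f v \<le> b"
    then show "Min (f ` V) = b \<longleftrightarrow> (\<forall>v\<in>V. f v = b)"
      unfolding eq using v by (metis order_antisym order_refl)
  }
qed

lemma Max_image_eq_iff:
  fixes f :: "'a \<Rightarrow> real"
  assumes "finite V" "V \<noteq> {}"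
  shows "(\<And>v. v \<in> V \<Longrightarrow> a \<le> f v) \<Longrightarrow> Max (f ` V) = a \<longleftrightarrow> (\<forall>v\<in>V. f v = a)"
    and "(\<And>v. v \<in> V \<Longrightarrow> f v \<le> b) \<Longrightarrow> Max (f ` V) = b \<longleftrightarrow> (\<exists>v\<in>V. f v = b)"
proof -
  obtain v where v: "v \<in> V" using assms by blast
  have eq: "Max (f ` V) = c \<longleftrightarrow> (\<exists>v\<in>V. f v = c) \<and> (\<forall>v\<in>V. f v \<le> c)" for c
    using assms by (auto simp: Max_eq_iff)
  {
    assume "\<And>v. v \<in> V \<Longrightarrow> a \<le> f v"
    then show "Max (f ` V) = a \<longleftrightarrow> (\<forall>v\<in>V. f v = a)"
      unfolding eq using v by (metis order_antisym order_refl)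
  next
    assume "\<And>v. v \<in> V \<Longrightarrow> f v \<le> b"
    then show "Max (f ` V) = b \<longleftrightarrow> (\<exists>v\<in>V. f v = b)"
      unfolding eq using v by (metis order_antisym order_refl)
  }
qed

theorem theorem2p1:
  fixes D :: "'a pair_pre_digraph" and n :: nat
  assumes "pair_digraph D"
    and "strongly_connected (with_proj D)"
    and "card (pverts D) = n"
    and "n \<ge> 3"
  shows "(1 \<le> proximity D \<and> proximity D \<le> real n / 2)
    \<and> (proximity D = 1 \<longleftrightarrow> (\<exists>u\<in>pverts D. out_degree (with_proj D) u = n - 1))
    \<and> (proximity D = real n / 2 \<longleftrightarrow> is_dicycle D)
    \<and> (1 \<le> remoteness D \<and> remoteness D \<le> real n / 2)
    \<and> (remoteness D = 1 \<longleftrightarrow> is_complete D)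
    \<and> (remoteness D = real n / 2 \<longleftrightarrow>
         strongly_connected (with_proj D) \<and>
         (\<exists>v. hamiltonian_dipath D v \<and>
            {(v ! (i - 1), v ! (j - 1)) | i j. 2 \<le> i + 1 \<and> i + 1 < j \<and> j \<le> n}
              \<subseteq> parcs (complement D)))"
proof -
  interpret pair_digraph D by fact
  interpret strong_digraph D by unfold_locales fact
  have n: "2 \<le> card (pverts D)" using assms by simp
  have V: "finite (pverts D)" "pverts D \<noteq> {}"
    using pair_finite_verts strong by (auto simp: strongly_connected_def)
  have prox: "proximity D = Min (average_distance D ` pverts D)"
    and rem: "remoteness D = Max (average_distance D ` pverts D)"
    by (simp_all add: proximity_def remoteness_def setcompr_eq_image)
  note b = average_distance_bounds[OF n, unfolded assms(3)]
  have "1 \<le> proximity D \<and> proximity D \<le> real n / 2"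
    unfolding prox using V b(1,2) by (auto simp: Min_le_iff simp del: le_divide_eq_numeral1)
  moreover have "proximity D = 1 \<longleftrightarrow> (\<exists>u\<in>pverts D. out_degree (with_proj D) u = n - 1)"
    unfolding prox using Min_image_eq_iff(1)[OF V b(1)] b(3) out_degree_eq_iff assms(3) by auto
  moreover have "proximity D = real n / 2 \<longleftrightarrow> is_dicycle D"
    unfolding prox is_dicycle_iff_single_valued[OF n] single_valued_iff_inj_distance
    using Min_image_eq_iff(2)[OF V b(2)] b(4) by auto
  moreover have "1 \<le> remoteness D \<and> remoteness D \<le> real n / 2"
    unfolding rem using V b(1,2) by (auto simp: Max_ge_iff simp del: le_divide_eq_numeral1)
  moreover have "remoteness D = 1 \<longleftrightarrow> is_complete D"
    unfolding rem is_complete_iff using Max_image_eq_iff(1)[OF V b(1)] b(3) by auto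
  moreover have "remoteness D = real n / 2 \<longleftrightarrow> strongly_connected (with_proj D) \<and>
      (\<exists>v. hamiltonian_dipath D v \<and>
        {(v ! (i - 1), v ! (j - 1)) | i j. 2 \<le> i + 1 \<and> i + 1 < j \<and> j \<le> n}
          \<subseteq> parcs (complement D))"
  proof -
    have "remoteness D = real n / 2 \<longleftrightarrow> (\<exists>u\<in>pverts D. inj_on (distance D u) (pverts D))"
      unfolding rem using Max_image_eq_iff(2)[OF V b(2)] b(4) by auto
    also have "\<dots> \<longleftrightarrow> (\<exists>vs. hamiltonian_dipath D vs \<and> no_forward_chord vs)"
      by (rule inj_distance_iff_hamiltonian_dipath)
    finally show ?thesis
      using no_forward_chord_iff_complement assms(3) strong by auto
  qed
  ultimately show ?thesis by blast
qed

end
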